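(* Let $\mathbb{O}$ denote the (real, 8-dimensional) octonions. If $m\ge 3$, then $$\mathrm{SL}_m(\mathbb{O})\cong \mathrm{SL}_{8m}(\mathbb{R}).$$
   Context: For a not necessarily associative ring $R$, $aE_{ij}$ denotes the $m\times m$ matrix with $a\in R$ in position $(i,j)$ and zeros elsewhere, $I$ is the identity matrix, and for $x\in M_m(R)$, $L_x$ is the left multiplication map $v\mapsto xv$ on column vectors $R^m$ (equivalently on $M_m(R)$). Definition: $\mathrm{SL}_m(R)$ is the group generated by $\{L_{I+aE_{ij}} : a\in R,\ i\neq j\}$ under composition. For $R=\mathbb{O}$ this agrees with Baez's definition: $\mathfrak{sl}_m(\mathbb{O})$ is the Lie algebra generated under commutators by $\{L_x : x\in M_m(\mathbb{O}),\ \operatorname{tr}x=0\}$, and $\mathrm{SL}_m(\mathbb{O})$ is the Lie group generated by exponentiating $\mathfrak{sl}_m(\mathbb{O})$. $\mathrm{SL}_{8m}(\mathbb{R})$ is the usual group of real $8m\times 8m$ matrices of determinant $1$. *)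

theory Defs
  imports "HOL-Analysis.Analysis" "HOL-Algebra.Bij" "HOL-Algebra.Generated_Groups"
begin

section \<open>Not necessarily associative rings\<close>

class nonassoc_ring_1 = ab_group_add + times + one +
  assumes nonassoc_distrib_right: "(a + b) * c = a * c + b * c"
    and nonassoc_distrib_left: "a * (b + c) = a * b + a * c"
    and nonassoc_mult_1_left: "1 * a = a"
    and nonassoc_mult_1_right: "a * 1 = a"
begin

lemma nonassoc_mult_zero_left: "0 * a = 0"
  using nonassoc_distrib_right[of 0 0 a] by simp

lemma nonassoc_mult_zero_right: "a * 0 = 0"
  using nonassoc_distrib_left[of a 0 0] by simp

lemma nonassoc_mult_minus_left: "(- a) * b = - (a * b)"
  using nonassoc_distrib_right[of "- a" a b]
  by (simp add: nonassoc_mult_zero_left eq_neg_iff_add_eq_0)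

end

class nonassoc_star_ring_1 = nonassoc_ring_1 +
  fixes star :: "'a \<Rightarrow> 'a"
  assumes star_add: "star (a + b) = star a + star b"
    and star_mult: "star (a * b) = star b * star a"
    and star_star: "star (star a) = a"
begin

lemma star_zero: "star 0 = 0"
  using star_add[of 0 0] by simp

lemma star_one: "star 1 = 1"
  by (metis nonassoc_mult_1_left nonassoc_mult_1_right star_mult star_star)

lemma star_minus: "star (- a) = - star a"
  using star_add[of "- a" a] by (simp add: star_zero eq_neg_iff_add_eq_0)

end

instantiation complex :: nonassoc_star_ring_1
begin

definition star_complex :: "complex \<Rightarrow> complex" where "star_complex = cnj"

instance
  by standard (simp_all add: star_complex_def algebra_simps)

end


section \<open>Octonions\<close>

text \<open>The Cayley--Dickson double of a *-algebra \<open>A\<close> is \<open>A \<times> A\<close> with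
  \<open>(a, b) (c, d) = (a c - d b*, a* d + c b)\<close> and \<open>(a, b)* = (a*, - b)\<close>.
  Doubling the complex numbers gives the quaternions, doubling the quaternions gives the
  octonions.\<close>

datatype 'a cayley_dickson = CD (cd_fst: 'a) (cd_snd: 'a)

instantiation cayley_dickson :: (nonassoc_star_ring_1) nonassoc_star_ring_1
begin

definition zero_cayley_dickson :: "'a cayley_dickson" where
  "0 = CD 0 0"

definition one_cayley_dickson :: "'a cayley_dickson" where
  "1 = CD 1 0"

definition plus_cayley_dickson :: "'a cayley_dickson \<Rightarrow> 'a cayley_dickson \<Rightarrow> 'a cayley_dickson" where
  "x + y = CD (cd_fst x + cd_fst y) (cd_snd x + cd_snd y)"

definition uminus_cayley_dickson :: "'a cayley_dickson \<Rightarrow> 'a cayley_dickson" where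
  "- x = CD (- cd_fst x) (- cd_snd x)"

definition minus_cayley_dickson :: "'a cayley_dickson \<Rightarrow> 'a cayley_dickson \<Rightarrow> 'a cayley_dickson" where
  "x - y = CD (cd_fst x - cd_fst y) (cd_snd x - cd_snd y)"

definition times_cayley_dickson :: "'a cayley_dickson \<Rightarrow> 'a cayley_dickson \<Rightarrow> 'a cayley_dickson" where
  "x * y = CD (cd_fst x * cd_fst y - cd_snd y * star (cd_snd x))
              (star (cd_fst x) * cd_snd y + cd_fst y * cd_snd x)"

definition star_cayley_dickson :: "'a cayley_dickson \<Rightarrow> 'a cayley_dickson" where
  "star x = CD (star (cd_fst x)) (- cd_snd x)"

instance
proof -
  have minus_right: "a * (- b) = - (a * b)" for a b :: 'a
    using nonassoc_distrib_left[of a "- b" b]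
    by (simp add: nonassoc_mult_zero_right eq_neg_iff_add_eq_0)
  have star_diff: "star (a - b) = star a - star b" for a b :: 'a
    using star_add[of a "- b"] by (simp add: star_minus)
  show "OFCLASS('a cayley_dickson, nonassoc_star_ring_1_class)"
    by standard
      (simp_all add: zero_cayley_dickson_def one_cayley_dickson_def plus_cayley_dickson_def
        uminus_cayley_dickson_def minus_cayley_dickson_def times_cayley_dickson_def
        star_cayley_dickson_def nonassoc_distrib_right nonassoc_distrib_left
        nonassoc_mult_1_left nonassoc_mult_1_right nonassoc_mult_zero_left
        nonassoc_mult_zero_right nonassoc_mult_minus_left minus_right
        star_add star_mult star_star star_zero star_one star_minus star_diff)
qed

end

type_synonym quaternion = "complex cayley_dickson"
type_synonym octonion = "quaternion cayley_dickson"


section \<open>Special linear groups\<close>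

definition matrix_unit :: "'a::nonassoc_ring_1 \<Rightarrow> 'm \<Rightarrow> 'm \<Rightarrow> 'a^'m^'m" where
  "matrix_unit a i j = (\<chi> k l. if k = i \<and> l = j then a else 0)"

text \<open>The library's \<open>*v\<close> is only available over associative semirings.\<close>

definition left_mult :: "'a::nonassoc_ring_1^'m^'m \<Rightarrow> 'a^'m \<Rightarrow> 'a^'m" where
  "left_mult x v = (\<chi> i. \<Sum>j\<in>UNIV. x $ i $ j * v $ j)"

definition elementary_left_mults :: "('a::nonassoc_ring_1^'m \<Rightarrow> 'a^'m) set" where
  "elementary_left_mults = {left_mult (mat 1 + matrix_unit a i j) | a i j. i \<noteq> j}"

lemma left_mult_elementary:
  fixes v :: "'a::nonassoc_ring_1^'m"
  assumes "i \<noteq> j"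
  shows "left_mult (mat 1 + matrix_unit a i j) v = v + axis i (a * v $ j)"
proof -
  have "(\<Sum>l\<in>UNIV. (mat 1 + matrix_unit a i j) $ k $ l * v $ l)
      = v $ k + (if k = i then a * v $ j else 0)" for k
  proof -
    have "(mat 1 + matrix_unit a i j) $ k $ l * v $ l
        = (if l = k then v $ l else 0) + (if l = j then if k = i then a * v $ l else 0 else 0)" for l
      by (auto simp: mat_def matrix_unit_def nonassoc_distrib_right nonassoc_mult_1_left
          nonassoc_mult_zero_left)
    then show ?thesis by (simp add: sum.distrib)
  qed
  then show ?thesis
    by (auto simp: left_mult_def vec_eq_iff axis_def)
qed

lemma elementary_left_mults_subset:
  "(elementary_left_mults :: ('a::nonassoc_ring_1^'m \<Rightarrow> 'a^'m) set) \<subseteq> carrier (BijGroup UNIV)"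
proof
  fix f :: "'a^'m \<Rightarrow> 'a^'m"
  assume "f \<in> elementary_left_mults"
  then obtain a i j where ij: "i \<noteq> j" and f: "f = left_mult (mat 1 + matrix_unit a i j)"
    by (auto simp: elementary_left_mults_def)
  let ?g = "left_mult (mat 1 + matrix_unit (- a) i j)"
  have "?g (f v) = v" "f (?g v) = v" for v
    using ij by (auto simp: f left_mult_elementary vec_eq_iff axis_def nonassoc_mult_minus_left)
  then have "bij f" by (metis bijI')
  then show "f \<in> carrier (BijGroup UNIV)"
    by (simp add: BijGroup_def Bij_def)
qed

definition SL :: "('a::nonassoc_ring_1^'m \<Rightarrow> 'a^'m) monoid" where
  "SL = (BijGroup UNIV)\<lparr>carrier := generate (BijGroup UNIV) elementary_left_mults\<rparr>"

lemma group_SL: "group (SL :: ('a::nonassoc_ring_1^'m \<Rightarrow> 'a^'m) monoid)"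
  unfolding SL_def
  by (intro group.subgroup_imp_group[OF group_BijGroup]
      group.generate_is_subgroup[OF group_BijGroup] elementary_left_mults_subset)

text \<open>The usual special linear group; the library's \<open>det\<close> needs a commutative ring, so this
  is separate from \<^const>\<open>SL\<close>.\<close>

definition special_linear_group :: "('a::comm_ring_1^'n^'n) monoid" where
  "special_linear_group = \<lparr>carrier = {A. det A = 1}, mult = (**), one = mat 1\<rparr>"

end

theory Submission
  imports Defs
begin

text \<open>Write \<open>E i j f\<close> for the map \<open>v \<mapsto> v + f (v j) e\<^sub>i\<close>. Since
  \<open>[E i j f, E j k g] = E i k (f g)\<close>, for \<open>m \<ge> 3\<close> the additive maps \<open>f\<close> of the octonions with
  all \<open>E i j f\<close> in the group are closed under composition, and they are closed under addition.
  They contain the left multiplications, which generate all real-linear maps: composing left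
  multiplications gives the projection to the quaternions, then on the quaternions also the right
  multiplications, hence the real part, hence all maps of rank one. So the group contains all
  elementary real transvections between different blocks, their commutators give those within a
  block, and transvections generate the real special linear group. Conversely every generator is
  itself a commutator of real-linear maps, so it has determinant \<open>1\<close>.\<close>

section \<open>Generation of the real special linear group by transvections\<close>

definition transvection :: "'n \<Rightarrow> 'n \<Rightarrow> real \<Rightarrow> real^'n^'n" where
  "transvection k l c = mat 1 + (\<chi> i j. if i = k \<and> j = l then c else 0)"

definition diagonal_matrix :: "('n \<Rightarrow> real) \<Rightarrow> real^'n^'n" where
  "diagonal_matrix f = (\<chi> i j. if i = j then f i else 0)"

text \<open>Products alone already give a group: the inverse of \<open>transvection k l c\<close> is
  \<open>transvection k l (- c)\<close>.\<close>

inductive_set transvection_products :: "(real^'n^'n) set" where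
  one: "mat 1 \<in> transvection_products"
| transvection: "k \<noteq> l \<Longrightarrow> transvection k l c \<in> transvection_products"
| mult: "A \<in> transvection_products \<Longrightarrow> B \<in> transvection_products \<Longrightarrow> A ** B \<in> transvection_products"

section \<open>Entries and determinants of transvections and diagonal matrices\<close>

lemma transvection_mult_nth:
  "(transvection k l c ** A) $ i $ j = A $ i $ j + (if i = k then c * A $ l $ j else 0)"
proof -
  have "transvection k l c $ i $ h * A $ h $ j
      = (if h = i then A $ h $ j else 0) + (if h = l then if i = k then c * A $ h $ j else 0 else 0)" for h
    by (auto simp: transvection_def mat_def distrib_right)
  then show ?thesis
    by (simp add: matrix_matrix_mult_def sum.distrib)
qed

lemma transvection_nth:
  "transvection k l c $ i $ j = of_bool (i = j) + (if i = k \<and> j = l then c else 0)"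
  by (simp add: transvection_def mat_def)

lemma transvection_mult_vector:
  "transvection k l c *v w = w + axis k (c * w $ l)"
proof -
  have "transvection k l c $ i $ h * w $ h
      = (if h = i then w $ h else 0) + (if h = l then if i = k then c * w $ h else 0 else 0)" for i h
    by (auto simp: transvection_def mat_def distrib_right)
  then show ?thesis
    by (simp add: matrix_vector_mult_def sum.distrib vec_eq_iff axis_def)
qed

lemma diagonal_matrix_mult_nth:
  "(diagonal_matrix f ** A) $ i $ j = f i * A $ i $ j"
proof -
  have "diagonal_matrix f $ i $ h * A $ h $ j = (if h = i then f h * A $ h $ j else 0)" for h
    by (auto simp: diagonal_matrix_def)
  then show ?thesis
    by (simp add: matrix_matrix_mult_def)
qed

lemma mult_diagonal_matrix_nth:
  "(A ** diagonal_matrix f) $ i $ j = A $ i $ j * f j"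
proof -
  have "A $ i $ h * diagonal_matrix f $ h $ j = (if h = j then A $ i $ h * f h else 0)" for h
    by (auto simp: diagonal_matrix_def)
  then show ?thesis
    by (simp add: matrix_matrix_mult_def)
qed

lemma diagonal_matrix_mult:
  "diagonal_matrix f ** diagonal_matrix g = diagonal_matrix (\<lambda>i. f i * g i)"
  by (simp add: vec_eq_iff diagonal_matrix_mult_nth) (simp add: diagonal_matrix_def)

lemma diagonal_matrix_one: "diagonal_matrix (\<lambda>_. 1) = mat 1"
  by (simp add: diagonal_matrix_def mat_def)

lemma det_diagonal_matrix: "det (diagonal_matrix f) = prod f UNIV"
  by (simp add: det_diagonal diagonal_matrix_def)

lemma det_transvection:
  assumes "k \<noteq> l"
  shows "det (transvection k l c) = 1"
proof -
  have "transvection k l c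
      = (\<chi> i. if i = k then row k (mat 1) + c *s row l (mat 1) else row i (mat 1))"
    using assms by (auto simp: vec_eq_iff transvection_def mat_def row_def)
  then show ?thesis
    using det_row_operation[OF assms, of "mat 1" c] by simp
qed

lemma det_transvection_products: "A \<in> transvection_products \<Longrightarrow> det A = 1"
  by (induction rule: transvection_products.induct) (simp_all add: det_transvection det_mul)

text \<open>Moving past the diagonal matrix only rescales \<open>c\<close> to
  \<open>f k * c / f l\<close>. This lets diagonal factors be collected on the right.\<close>

lemma diagonal_conjugate_transvection_products:
  assumes "A \<in> transvection_products" "\<And>i. f i \<noteq> 0"
  shows "\<exists>B\<in>transvection_products. diagonal_matrix f ** A = B ** diagonal_matrix f"
  using assms(1)
proof induction
  case one
  show ?case
    by (rule bexI[of _ "mat 1"]) (simp_all add: transvection_products.one)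
next
  case (transvection k l c)
  have "diagonal_matrix f ** transvection k l c
      = transvection k l (f k * c / f l) ** diagonal_matrix f"
    using assms(2)
    by (auto simp: vec_eq_iff diagonal_matrix_mult_nth mult_diagonal_matrix_nth transvection_nth)
  with transvection show ?case
    using transvection_products.transvection by blast
next
  case (mult A B)
  then show ?case
    by (metis matrix_mul_assoc transvection_products.mult)
qed

text \<open>A Weyl element: on the plane of \<open>k\<close> and \<open>l\<close> it has rows
  \<open>(0, t)\<close> and \<open>(- 1 / t, 0)\<close>, so for \<open>t = 1\<close> it is a
  transposition up to sign.\<close>

lemma weyl_product:
  assumes "k \<noteq> l" "t \<noteq> 0"
  shows "(transvection k l t ** (transvection l k (- 1 / t) ** transvection k l t)) $ i $ j
    = (if i = k then if j = l then t else 0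
       else if i = l then if j = k then - 1 / t else 0
       else of_bool (i = j))"
  using assms by (auto simp: transvection_mult_nth transvection_nth)

lemma weyl_product_in:
  assumes "k \<noteq> l"
  shows "transvection k l t ** (transvection l k s ** transvection k l t) \<in> transvection_products"
  using assms by (intro transvection_products.mult transvection_products.transvection) auto

text \<open>Whitehead's lemma: \<open>diag (t, 1/t)\<close> is a product of two Weyl elements.\<close>

lemma diagonal_matrix_in_transvection_products:
  assumes "k \<noteq> l" "t \<noteq> 0"
  shows "diagonal_matrix ((\<lambda>_. 1)(k := t, l := 1 / t)) \<in> transvection_products"
proof -
  define w where "w s = transvection k l s ** (transvection l k (- 1 / s) ** transvection k l s)" for s
  have w: "w s $ i $ j = (if i = k then if j = l then s else 0
       else if i = l then if j = k then - 1 / s else 0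
       else of_bool (i = j))" if "s \<noteq> 0" for s i j
    using weyl_product[OF assms(1) that] by (simp add: w_def)
  have "w t ** w (- 1) = diagonal_matrix ((\<lambda>_. 1)(k := t, l := 1 / t))"
    using assms
    by (auto simp: vec_eq_iff w_def[of t] matrix_mul_assoc[symmetric] transvection_mult_nth w
        diagonal_matrix_def)
  moreover have "w t ** w (- 1) \<in> transvection_products"
    unfolding w_def by (intro transvection_products.mult weyl_product_in assms)
  ultimately show ?thesis by simp
qed

text \<open>The entries are moved into position \<open>k\<close> one at a time; each move multiplies
  by \<open>diag (f x, 1 / f x)\<close> at \<open>x\<close> and \<open>k\<close>, a product of
  transvections.\<close>

lemma diagonal_matrix_factorization:
  assumes "\<And>i. f i \<noteq> 0"
  shows "\<exists>B\<in>transvection_products.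
    diagonal_matrix f = B ** diagonal_matrix ((\<lambda>_. 1)(k := prod f UNIV))"
proof -
  \<comment> \<open>\<open>F\<close> holds the indices other than \<open>k\<close> whose entry may
    still differ from 1.\<close>
  have "\<exists>B\<in>transvection_products.
      diagonal_matrix f = B ** diagonal_matrix ((\<lambda>_. 1)(k := f k * prod f F))"
    if "finite F" "k \<notin> F" "\<And>i. f i \<noteq> 0" "\<And>i. i \<notin> insert k F \<Longrightarrow> f i = 1" for F f
    using that
  proof (induction F arbitrary: f rule: finite_induct)
    case empty
    then have "f = (\<lambda>_. 1)(k := f k)" by auto
    then show ?case
      using transvection_products.one by (intro bexI[of _ "mat 1"]) auto
  next
    case (insert x F)
    \<comment> \<open>\<open>g\<close> has the entry at \<open>x\<close> shifted into position
      \<open>k\<close>; the factor \<open>h\<close> undoes the shift.\<close>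
    define g where "g = f(x := 1, k := f k * f x)"
    define h where "h = diagonal_matrix ((\<lambda>_. 1)(x := f x, k := 1 / f x))"
    have "prod g F = prod f F"
      using insert.hyps insert.prems by (intro prod.cong) (auto simp: g_def)
    then have prod_g: "g k * prod g F = f k * prod f (insert x F)"
      using insert.hyps by (simp add: g_def)
    have "\<exists>B\<in>transvection_products.
        diagonal_matrix g = B ** diagonal_matrix ((\<lambda>_. 1)(k := g k * prod g F))"
      using insert.prems by (intro insert.IH) (auto simp: g_def)
    then obtain B where B: "B \<in> transvection_products"
      "diagonal_matrix g = B ** diagonal_matrix ((\<lambda>_. 1)(k := f k * prod f (insert x F)))"
      unfolding prod_g by blast
    have "diagonal_matrix f = h ** diagonal_matrix g"
      unfolding diagonal_matrix_mult h_def
      using insert.prems by (intro arg_cong[where f = diagonal_matrix]) (auto simp: g_def)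
    then have "diagonal_matrix f
        = (h ** B) ** diagonal_matrix ((\<lambda>_. 1)(k := f k * prod f (insert x F)))"
      by (simp only: B(2) matrix_mul_assoc)
    moreover have "h \<in> transvection_products"
      unfolding h_def using insert.prems by (intro diagonal_matrix_in_transvection_products) auto
    ultimately show ?case
      using transvection_products.mult[OF _ B(1)] by blast
  qed
  from this[of "UNIV - {k}" f] assms show ?thesis
    by (simp add: prod.remove[of UNIV k])
qed

text \<open>Gaussian elimination, with the determinant as the single diagonal entry left
  over.\<close>

lemma transvection_factorization:
  fixes A :: "real^'n^'n"
  assumes "det A \<noteq> 0"
  shows "\<exists>B\<in>transvection_products. A = B ** diagonal_matrix ((\<lambda>_. 1)(k := det A))"
proof -
  define D where "D d = (diagonal_matrix ((\<lambda>_. 1)(k := d)) :: real^'n^'n)" for d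
  \<comment> \<open>The induction also visits singular matrices; the implication makes
    \<open>P\<close> vacuous for them.\<close>
  define P where
    "P A \<longleftrightarrow> (det A \<noteq> 0 \<longrightarrow> (\<exists>B\<in>transvection_products. A = B ** D (det A)))" for A
  have D_mult: "D c ** D d = D (c * d)" for c d
    unfolding D_def diagonal_matrix_mult by (intro arg_cong[where f = diagonal_matrix]) auto
  have D_1: "D 1 = mat 1"
    unfolding D_def by (auto intro: arg_cong[where f = diagonal_matrix] simp flip: diagonal_matrix_one)
  have P_products: "P A" if "A \<in> transvection_products" for A
    using that det_transvection_products[OF that] by (auto simp: P_def D_1)
  have P_diagonal: "P (diagonal_matrix f)" for f
    unfolding P_def D_def det_diagonal_matrix
    using diagonal_matrix_factorization[of f k] by auto
  have P_mult: "P (A ** B)" if PA: "P A" and PB: "P B" for A B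
    unfolding P_def
  proof
    assume "det (A ** B) \<noteq> 0"
    then have nz: "det A \<noteq> 0" "det B \<noteq> 0" by (auto simp: det_mul)
    then obtain A' B' where A': "A' \<in> transvection_products" "A = A' ** D (det A)"
      and B': "B' \<in> transvection_products" "B = B' ** D (det B)"
      using PA PB unfolding P_def by blast
    \<comment> \<open>\<open>D (det A)\<close> is carried to the right past \<open>B'\<close>, so
      that the two diagonal factors merge.\<close>
    have "\<exists>C\<in>transvection_products. D (det A) ** B' = C ** D (det A)"
      unfolding D_def using B'(1) nz
      by (intro diagonal_conjugate_transvection_products) auto
    then obtain C where C: "C \<in> transvection_products" "D (det A) ** B' = C ** D (det A)"
      by blast
    have "A ** B = A' ** (D (det A) ** B') ** D (det B)"
      using A'(2) B'(2) by (metis matrix_mul_assoc)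
    also have "\<dots> = (A' ** C) ** D (det (A ** B))"
      by (simp add: C(2) D_mult det_mul flip: matrix_mul_assoc)
    finally show "\<exists>B'\<in>transvection_products. A ** B = B' ** D (det (A ** B))"
      using transvection_products.mult[OF A'(1) C(1)] by blast
  qed
  have "P A"
  proof (induction A rule: induct_matrix_elementary)
    case (1 A B)
    then show ?case by (rule P_mult)
  next
    case (2 A i)
    then show ?case using det_zero_row(2) by (auto simp: P_def)
  next
    case (3 A)
    then have "A = diagonal_matrix (\<lambda>i. A $ i $ i)"
      by (auto simp: vec_eq_iff diagonal_matrix_def)
    then show ?case using P_diagonal by metis
  next
    case (4 m n)
    \<comment> \<open>A transposition has determinant -1: it is the Weyl element for
      \<open>t = 1\<close> after a sign change in column \<open>m\<close>.\<close>
    let ?w = "transvection m n 1 ** (transvection n m (- 1) ** transvection m n 1)"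
    have "(\<chi> i j. mat 1 $ i $ Transposition.transpose m n j)
      = ?w ** diagonal_matrix ((\<lambda>_. 1)(m := - 1))"
      using 4 weyl_product[OF 4, of 1]
      by (auto simp: vec_eq_iff mult_diagonal_matrix_nth mat_def
          Transposition.transpose_def)
    then show ?case
      using P_mult[OF P_products[OF weyl_product_in] P_diagonal] 4 by metis
  next
    case (5 m n c)
    then have "(\<chi> i j. if i = m \<and> j = n then c else of_bool (i = j)) = transvection m n c"
      by (auto simp: vec_eq_iff transvection_nth)
    then show ?case
      using P_products[OF transvection_products.transvection[OF 5]] by metis
  qed
  then show ?thesis using assms by (simp add: P_def D_def)
qed

theorem det_eq_1_iff_transvection_products:
  "det A = 1 \<longleftrightarrow> A \<in> transvection_products"
proof
  \<comment> \<open>\<open>undefined\<close> merely names some index; for determinant 1 the leftover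
    diagonal factor is the identity.\<close>
  have one: "(\<lambda>_. 1)(undefined := 1) = (\<lambda>_. 1 :: real)" by auto
  assume "det A = 1"
  then show "A \<in> transvection_products"
    using transvection_factorization[of A undefined]
    by (auto simp: one diagonal_matrix_one)
qed (rule det_transvection_products)


lemma det_1_inverse:
  fixes A :: "real^'n^'n"
  assumes "det A = 1"
  shows "\<exists>B. A ** B = mat 1 \<and> B ** A = mat 1 \<and> det B = 1"
proof -
  obtain B where B: "A ** B = mat 1" "B ** A = mat 1"
    using assms invertible_det_nz[of A] by (auto simp: invertible_def)
  then have "det B = 1"
    using det_mul[of A B] assms by simp
  with B show ?thesis by blast
qed


section \<open>Octonions as a real vector space\<close>

instantiation cayley_dickson :: ("{real_vector, nonassoc_star_ring_1}") real_vector
begin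

definition scaleR_cayley_dickson :: "real \<Rightarrow> 'a cayley_dickson \<Rightarrow> 'a cayley_dickson" where
  "r *\<^sub>R x = CD (r *\<^sub>R cd_fst x) (r *\<^sub>R cd_snd x)"

instance
  by standard
    (simp_all add: scaleR_cayley_dickson_def plus_cayley_dickson_def scaleR_add_left scaleR_add_right)

end

text \<open>One boolean per doubling, outermost first: octonion half, quaternion half, then
  \<open>Re\<close> or \<open>Im\<close>.\<close>

definition octonion_coord :: "bool \<times> bool \<times> bool \<Rightarrow> octonion \<Rightarrow> real" where
  "octonion_coord = (\<lambda>(a, b, c) x. (if c then Im else Re)
    ((if b then cd_snd else cd_fst) ((if a then cd_snd else cd_fst) x)))"

definition octonion_of_coords :: "(bool \<times> bool \<times> bool \<Rightarrow> real) \<Rightarrow> octonion" where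
  "octonion_of_coords f = CD
    (CD (Complex (f (False, False, False)) (f (False, False, True)))
        (Complex (f (False, True, False)) (f (False, True, True))))
    (CD (Complex (f (True, False, False)) (f (True, False, True)))
        (Complex (f (True, True, False)) (f (True, True, True))))"

definition octonion_unit :: "bool \<times> bool \<times> bool \<Rightarrow> octonion" where
  "octonion_unit s = octonion_of_coords (\<lambda>t. of_bool (t = s))"

lemma cayley_dickson_eq_iff: "x = y \<longleftrightarrow> cd_fst x = cd_fst y \<and> cd_snd x = cd_snd y"
  by (cases x; cases y) simp

lemmas octonion_simps =
  zero_cayley_dickson_def one_cayley_dickson_def plus_cayley_dickson_def
  uminus_cayley_dickson_def minus_cayley_dickson_def times_cayley_dickson_def
  star_cayley_dickson_def scaleR_cayley_dickson_def star_complex_def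
  cayley_dickson_eq_iff complex_eq_iff octonion_coord_def octonion_of_coords_def octonion_unit_def

lemma octonion_of_coords_coord [simp]: "octonion_of_coords (\<lambda>s. octonion_coord s x) = x"
  by (simp add: octonion_simps)

lemma octonion_coord_of_coords [simp]: "octonion_coord s (octonion_of_coords f) = f s"
  by (cases s) (auto simp: octonion_simps)

lemma linear_octonion_coord: "linear (octonion_coord s)"
  by (intro linearI; cases s) (auto simp: octonion_simps)

lemma octonion_of_coords_add:
  "octonion_of_coords (\<lambda>s. f s + g s) = octonion_of_coords f + octonion_of_coords g"
  by (simp add: octonion_simps)

lemma octonion_of_coords_scale:
  "octonion_of_coords (\<lambda>s. r * f s) = r *\<^sub>R octonion_of_coords f"
  by (simp add: octonion_simps)

lemma octonion_mult_scaleR_left: "(r *\<^sub>R x) * y = r *\<^sub>R (x * y)" for x y :: octonion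
  by (simp add: octonion_simps algebra_simps)

lemma octonion_mult_scaleR_right: "x * (r *\<^sub>R y) = r *\<^sub>R (x * y)" for x y :: octonion
  by (simp add: octonion_simps algebra_simps)


section \<open>The algebra generated by left multiplications\<close>

inductive_set left_mult_algebra :: "('a::nonassoc_ring_1 \<Rightarrow> 'a) set" where
  left: "(*) a \<in> left_mult_algebra"
| add: "f \<in> left_mult_algebra \<Longrightarrow> g \<in> left_mult_algebra \<Longrightarrow> (\<lambda>x. f x + g x) \<in> left_mult_algebra"
| comp: "f \<in> left_mult_algebra \<Longrightarrow> g \<in> left_mult_algebra \<Longrightarrow> (\<lambda>x. f (g x)) \<in> left_mult_algebra"

lemma additive_left_mult_algebra: "f \<in> left_mult_algebra \<Longrightarrow> Modules.additive f"
  by (induction rule: left_mult_algebra.induct)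
    (auto simp: Modules.additive_def nonassoc_distrib_left algebra_simps)

text \<open>Scaling by \<open>r\<close> is itself a left multiplication, by
  \<open>r *\<^sub>R 1\<close>.\<close>

lemma scaleR_left_mult_algebra:
  fixes f :: "octonion \<Rightarrow> octonion"
  assumes "f \<in> left_mult_algebra"
  shows "(\<lambda>x. r *\<^sub>R f x) \<in> left_mult_algebra"
  using left_mult_algebra.comp[OF left_mult_algebra.left[of "r *\<^sub>R 1"] assms]
  by (simp add: octonion_mult_scaleR_left nonassoc_mult_1_left)

definition quaternion_projection :: "octonion \<Rightarrow> octonion" where
  "quaternion_projection x = CD (cd_fst x) 0"

text \<open>In this doubling convention the units satisfy \<open>i j k = 1\<close>, so \<open>i (j (k x))\<close> is \<open>x\<close> on the
  quaternions and \<open>- x\<close> on their complement.\<close>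

lemma quaternion_projection_in: "quaternion_projection \<in> left_mult_algebra"
proof -
  let ?i = "octonion_unit (False, False, True)"
    and ?j = "octonion_unit (False, True, False)"
    and ?k = "octonion_unit (False, True, True)"
  have "(\<lambda>x. (1/2) *\<^sub>R (1 * x + ?i * (?j * (?k * x)))) \<in> left_mult_algebra"
    by (rule scaleR_left_mult_algebra[OF left_mult_algebra.add[OF left_mult_algebra.left
          left_mult_algebra.comp[OF left_mult_algebra.left
            left_mult_algebra.comp[OF left_mult_algebra.left left_mult_algebra.left]]]])
  also have "(\<lambda>x. (1/2) *\<^sub>R (1 * x + ?i * (?j * (?k * x)))) = quaternion_projection"
    by (simp add: fun_eq_iff quaternion_projection_def octonion_simps)
  finally show ?thesis .
qed

text \<open>On the quaternions, left multiplication by \<open>(0, u)\<close> followed by left multiplication by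
  \<open>(0, 1)\<close> is right multiplication by \<open>- u\<close>, and the real part of a quaternion \<open>c\<close> is the average
  of \<open>c\<close> and the three \<open>- u c u\<close> for the imaginary units \<open>u\<close>.\<close>

lemma real_part_in: "(\<lambda>x. octonion_coord (False, False, False) x *\<^sub>R 1) \<in> left_mult_algebra"
proof -
  let ?P = quaternion_projection
  define q where "q b c x = octonion_unit (False, b, c) *
    (octonion_unit (True, False, False) * (octonion_unit (True, b, c) * ?P x))" for b c x
  have q: "q b c \<in> left_mult_algebra" for b c
    unfolding q_def
    by (rule left_mult_algebra.comp[OF left_mult_algebra.left
          left_mult_algebra.comp[OF left_mult_algebra.left
            left_mult_algebra.comp[OF left_mult_algebra.left quaternion_projection_in]]])
  have "(\<lambda>x. (1/4) *\<^sub>R (?P x + (q False True x + (q True False x + q True True x)))) \<in> left_mult_algebra"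
    by (intro scaleR_left_mult_algebra left_mult_algebra.add quaternion_projection_in q)
  also have "(\<lambda>x. (1/4) *\<^sub>R (?P x + (q False True x + (q True False x + q True True x))))
      = (\<lambda>x. octonion_coord (False, False, False) x *\<^sub>R 1)"
    by (simp add: fun_eq_iff q_def quaternion_projection_def octonion_simps)
  finally show ?thesis .
qed

text \<open>The units are orthonormal for the inner product given by the real part of
  \<open>star a * b\<close>.\<close>

lemma octonion_coord_eq_real_part:
  "octonion_coord s x = octonion_coord (False, False, False) (star (octonion_unit s) * x)"
  by (cases s) (auto simp: octonion_simps)

text \<open>A coordinate is a real part after a left multiplication, and a further left
  multiplication by \<open>a\<close> moves the real line onto that of \<open>a\<close>.\<close>

lemma rank_one_in_left_mult_algebra:
  "(\<lambda>x. octonion_coord s x *\<^sub>R a) \<in> left_mult_algebra"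
proof -
  have "(\<lambda>x. a * (octonion_coord (False, False, False) (star (octonion_unit s) * x) *\<^sub>R 1))
      \<in> left_mult_algebra"
    by (rule left_mult_algebra.comp[OF left_mult_algebra.left
          left_mult_algebra.comp[OF real_part_in left_mult_algebra.left]])
  then show ?thesis
    by (simp add: octonion_coord_eq_real_part[of s, symmetric] octonion_mult_scaleR_right nonassoc_mult_1_right)
qed


section \<open>The group generated by elementary left multiplications\<close>

text \<open>The \<open>E i j f\<close> of the overview; \<open>f\<close> may be any map, not just a
  left multiplication.\<close>

definition elementary_map :: "'m \<Rightarrow> 'm \<Rightarrow> ('a::ab_group_add \<Rightarrow> 'a) \<Rightarrow> 'a^'m \<Rightarrow> 'a^'m" where
  "elementary_map i j f v = v + axis i (f (v $ j))"

lemma elementary_left_mults_eq: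
  "(elementary_left_mults :: ('a::nonassoc_ring_1^'m::finite \<Rightarrow> _) set)
    = {elementary_map i j ((*) a) | a i j. i \<noteq> j}"
proof -
  have "left_mult (mat 1 + matrix_unit a i j) = elementary_map i j ((*) a)"
    if "i \<noteq> j" for a :: 'a and i j :: 'm
    using that by (simp add: fun_eq_iff left_mult_elementary elementary_map_def)
  then show ?thesis
    unfolding elementary_left_mults_def by (intro Collect_cong) metis
qed

lemma mult_minus_fun:
  "(*) (- a) = (\<lambda>x :: 'a::nonassoc_ring_1. - (a * x))"
  by (simp add: fun_eq_iff nonassoc_mult_minus_left)

lemma elementary_map_add:
  "i \<noteq> j \<Longrightarrow> elementary_map i j f \<circ> elementary_map i j g = elementary_map i j (\<lambda>x. f x + g x)"
  by (auto simp: fun_eq_iff elementary_map_def vec_eq_iff axis_def)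

lemma elementary_map_zero: "elementary_map i j (\<lambda>_. 0) = id"
  by (auto simp: fun_eq_iff elementary_map_def vec_eq_iff axis_def)

text \<open>Coordinate \<open>i\<close> gains \<open>f (v $ j) - f (v $ j - g (v $ k))\<close>,
  which additivity reduces to \<open>f (g (v $ k))\<close>; the change to coordinate
  \<open>j\<close> is undone.\<close>

lemma elementary_map_commutator:
  assumes "Modules.additive f" "i \<noteq> j" "j \<noteq> k" "i \<noteq> k"
  shows "elementary_map i j f \<circ> elementary_map j k g \<circ> elementary_map i j (\<lambda>x. - f x)
    \<circ> elementary_map j k (\<lambda>x. - g x) = elementary_map i k (\<lambda>x. f (g x))"
proof -
  interpret Modules.additive f by fact
  show ?thesis
    using assms(2-) by (auto simp: fun_eq_iff elementary_map_def vec_eq_iff axis_def add diff)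
qed

section \<open>Elements of \<open>SL\<close> as plain functions under composition\<close>

lemma BijGroup_UNIV_simps:
  "carrier (BijGroup UNIV) = {f. bij f}"
  "\<one>\<^bsub>BijGroup UNIV\<^esub> = id"
  "bij f \<Longrightarrow> bij g \<Longrightarrow> f \<otimes>\<^bsub>BijGroup UNIV\<^esub> g = f \<circ> g"
  by (auto simp: BijGroup_def Bij_def compose_def fun_eq_iff)

lemma carrier_SL: "carrier SL = generate (BijGroup UNIV) elementary_left_mults"
  by (simp add: SL_def)

lemma bij_SL: "f \<in> carrier SL \<Longrightarrow> bij f"
  using group.generate_in_carrier[OF group_BijGroup elementary_left_mults_subset]
  by (auto simp: carrier_SL BijGroup_UNIV_simps)

lemma mult_SL: "f \<in> carrier SL \<Longrightarrow> g \<in> carrier SL \<Longrightarrow> f \<otimes>\<^bsub>SL\<^esub> g = f \<circ> g"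
  using bij_SL[of f] bij_SL[of g] by (simp add: SL_def BijGroup_UNIV_simps)

lemma one_SL: "\<one>\<^bsub>SL\<^esub> = id"
  by (simp add: SL_def BijGroup_UNIV_simps)

lemma id_in_SL: "id \<in> carrier SL"
  using group.is_monoid[OF group_SL, THEN monoid.one_closed] by (simp add: one_SL)

lemma comp_in_SL: "f \<in> carrier SL \<Longrightarrow> g \<in> carrier SL \<Longrightarrow> f \<circ> g \<in> carrier SL"
  using group.is_monoid[OF group_SL, THEN monoid.m_closed] by (metis mult_SL)

lemma inverse_in_SL:
  assumes "f \<in> carrier SL" "f \<circ> g = id"
  shows "g \<in> carrier SL"
proof -
  let ?h = "inv\<^bsub>SL\<^esub> f"
  have h: "?h \<in> carrier SL" "?h \<circ> f = id"
    using assms(1) group.inv_closed[OF group_SL assms(1)] group.l_inv[OF group_SL assms(1)]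
    by (simp_all add: mult_SL one_SL)
  have "g = (?h \<circ> f) \<circ> g" by (simp add: h)
  also have "\<dots> = ?h" by (simp add: comp_assoc assms(2))
  finally show ?thesis using h by simp
qed

text \<open>The spare index for commutators: here \<open>m \<ge> 3\<close> enters.\<close>

lemma ex_distinct_index:
  fixes i j :: "'m::finite"
  assumes "CARD('m) \<ge> 3"
  shows "\<exists>k. i \<noteq> k \<and> k \<noteq> j"
proof (rule ccontr)
  assume "\<not> ?thesis"
  then have "(UNIV :: 'm set) \<subseteq> {i, j}" by auto
  then have "CARD('m) \<le> card {i, j}" by (intro card_mono) auto
  then show False using assms by (cases "i = j") auto
qed

text \<open>Sums become products in one position, composites become commutators. The positions stay
  arbitrary in the induction because a composite at \<open>(i, j)\<close> calls on
  \<open>(i, k)\<close> and \<open>(k, j)\<close>.\<close>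

lemma elementary_map_in_SL:
  fixes i j :: "'m::finite"
  assumes "CARD('m) \<ge> 3" "f \<in> left_mult_algebra" "i \<noteq> j"
  shows "elementary_map i j f \<in> carrier SL"
  using assms(2,3)
proof (induction arbitrary: i j)
  case (left a)
  then show ?case
    by (auto simp: carrier_SL elementary_left_mults_eq intro!: generate.incl)
next
  case (add f g)
  then show ?case
    using comp_in_SL[OF add.IH(1)[OF add.prems] add.IH(2)[OF add.prems]]
    by (simp add: elementary_map_add)
next
  case (comp f g)
  obtain k where k: "i \<noteq> k" "k \<noteq> j"
    by (metis ex_distinct_index[OF assms(1)])
  have neg: "elementary_map a b (\<lambda>x. - h x) \<in> carrier SL"
    if "elementary_map a b h \<in> carrier SL" "a \<noteq> b" for h :: "'a \<Rightarrow> 'a" and a b :: 'm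
    by (rule inverse_in_SL[OF that(1)]) (simp add: elementary_map_add[OF that(2)] elementary_map_zero)
  have f: "elementary_map i k f \<in> carrier SL" and g: "elementary_map k j g \<in> carrier SL"
    using comp.IH k by blast+
  show ?case
    using comp_in_SL[OF comp_in_SL[OF comp_in_SL[OF f g] neg[OF f k(1)]] neg[OF g k(2)]]
      elementary_map_commutator[OF additive_left_mult_algebra[OF comp.hyps(1)] k comp.prems, of g]
    by simp
qed


section \<open>Real coordinates\<close>

context
  fixes \<beta> :: "'n::finite \<Rightarrow> 'm::finite \<times> (bool \<times> bool \<times> bool)"
  assumes bij: "bij \<beta>"
begin

text \<open>\<open>\<beta>\<close> labels each real index by an octonion entry and a coordinate of
  it; indices with equal first label form a block.\<close>

definition to_real :: "octonion^'m \<Rightarrow> real^'n" where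
  "to_real v = (\<chi> k. octonion_coord (snd (\<beta> k)) (v $ fst (\<beta> k)))"

definition from_real :: "real^'n \<Rightarrow> octonion^'m" where
  "from_real w = (\<chi> i. octonion_of_coords (\<lambda>s. w $ inv_into UNIV \<beta> (i, s)))"

definition matrix_action :: "real^'n^'n \<Rightarrow> octonion^'m \<Rightarrow> octonion^'m" where
  "matrix_action A v = from_real (A *v to_real v)"

lemma inv_\<beta> [simp]: "\<beta> (inv_into UNIV \<beta> x) = x" "inv_into UNIV \<beta> (\<beta> k) = k"
  using bij by (simp_all add: bij_is_surj surj_f_inv_f bij_is_inj)

lemma from_real_to_real [simp]: "from_real (to_real v) = v"
  by (simp add: from_real_def to_real_def vec_eq_iff)

lemma to_real_from_real [simp]: "to_real (from_real w) = w"
  by (simp add: from_real_def to_real_def vec_eq_iff)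

lemma to_real_nth: "to_real v $ k = octonion_coord (snd (\<beta> k)) (v $ fst (\<beta> k))"
  by (simp add: to_real_def)

lemma linear_to_real: "linear to_real"
  by (intro linearI)
    (simp_all add: to_real_def vec_eq_iff linear_add[OF linear_octonion_coord]
      linear_scale[OF linear_octonion_coord])

lemma linear_from_real: "linear from_real"
  by (intro linearI)
    (simp_all add: from_real_def vec_eq_iff octonion_of_coords_add octonion_of_coords_scale)

lemma from_real_axis:
  "from_real (axis k r) = axis (fst (\<beta> k)) (r *\<^sub>R octonion_unit (snd (\<beta> k)))"
proof -
  have eq: "inv_into UNIV \<beta> (i, s) = k \<longleftrightarrow> i = fst (\<beta> k) \<and> s = snd (\<beta> k)" for i s
    by (metis inv_\<beta> prod.collapse prod.inject)
  have "(\<lambda>s. axis k r $ inv_into UNIV \<beta> (i, s)) = (\<lambda>s. (if i = fst (\<beta> k) then r else 0) * of_bool (s = snd (\<beta> k)))" for i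
    by (auto simp: axis_def eq)
  then show ?thesis
    by (simp add: from_real_def vec_eq_iff octonion_of_coords_scale octonion_unit_def axis_def)
qed

lemma matrix_action_one: "matrix_action (mat 1) = id"
  by (simp add: matrix_action_def fun_eq_iff)

lemma matrix_action_mult: "matrix_action (A ** B) = matrix_action A \<circ> matrix_action B"
  by (simp add: matrix_action_def fun_eq_iff matrix_vector_mul_assoc)

lemma inj_matrix_action: "inj matrix_action"
proof (rule injI)
  fix A B assume "matrix_action A = matrix_action B"
  then have "to_real (matrix_action A (from_real w)) = to_real (matrix_action B (from_real w))" for w
    by simp
  then show "A = B"
    by (simp add: matrix_action_def matrix_eq)
qed

text \<open>The bridge between the two kinds of transvection: reading one real coordinate and
  writing along one unit is a rank-one map of octonions. The two blocks may coincide.\<close>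

lemma matrix_action_transvection:
  "matrix_action (transvection k l c) = elementary_map (fst (\<beta> k)) (fst (\<beta> l))
    (\<lambda>x. octonion_coord (snd (\<beta> l)) x *\<^sub>R (c *\<^sub>R octonion_unit (snd (\<beta> k))))"
  by (simp add: fun_eq_iff matrix_action_def transvection_mult_vector linear_add[OF linear_from_real]
      from_real_axis elementary_map_def to_real_nth mult.commute)

lemma matrix_action_in_SL:
  assumes card: "CARD('m) \<ge> 3" and "det A = 1"
  shows "matrix_action A \<in> carrier SL"
proof -
  have off_block: "matrix_action (transvection k l c) \<in> carrier SL" if "fst (\<beta> k) \<noteq> fst (\<beta> l)" for k l c
    unfolding matrix_action_transvection
    by (intro elementary_map_in_SL card rank_one_in_left_mult_algebra that)
  have "A \<in> transvection_products"
    using assms by (simp add: det_eq_1_iff_transvection_products)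
  then show ?thesis
  proof induction
    case one
    then show ?case using id_in_SL by (simp only: matrix_action_one)
  next
    case (transvection k l c)
    show ?case
    proof (cases "fst (\<beta> k) = fst (\<beta> l)")
      case True
      obtain i where "fst (\<beta> k) \<noteq> i"
        using ex_distinct_index[OF card, of "fst (\<beta> k)"] by blast
      then obtain p where p: "fst (\<beta> p) \<noteq> fst (\<beta> k)"
        by (metis inv_\<beta>(1) fst_conv)
      with True have "l \<noteq> p" by auto
      \<comment> \<open>Inside a block the transvection is a commutator through an index
        \<open>p\<close> of another block, so all four factors join different blocks.\<close>
      have factors: "transvection k l c = transvection k p c
          ** (transvection p l 1 ** (transvection k p (- c) ** transvection p l (- 1)))"
        using transvection p \<open>l \<noteq> p\<close>
        by (auto simp: vec_eq_iff transvection_mult_nth transvection_nth)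
      show ?thesis
        unfolding factors matrix_action_mult using True p by (intro comp_in_SL off_block) auto
    qed (rule off_block)
  next
    case (mult A B)
    then show ?case unfolding matrix_action_mult by (intro comp_in_SL)
  qed
qed

text \<open>Real-linearity gives a matrix; it is a commutator of invertible matrices through a third
  index, which forces the determinant.\<close>

lemma elementary_left_mults_matrix_action:
  assumes card: "CARD('m) \<ge> 3" and "h \<in> elementary_left_mults"
  shows "\<exists>A. det A = 1 \<and> h = matrix_action A"
proof -
  define M where "M i j a = matrix (to_real \<circ> elementary_map i j ((*) a) \<circ> from_real)" for i j a
  have M: "matrix_action (M i j a) = elementary_map i j ((*) a)" for i j a
  proof -
    have "linear (elementary_map i j ((*) a))"
      by (intro linearI)
        (auto simp: elementary_map_def vec_eq_iff axis_def nonassoc_distrib_left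
          octonion_mult_scaleR_right scaleR_add_right)
    then have "linear (to_real \<circ> elementary_map i j ((*) a) \<circ> from_real)"
      by (intro linear_compose linear_to_real linear_from_real)
    then show ?thesis
      by (simp add: fun_eq_iff matrix_action_def M_def matrix_works)
  qed
  \<comment> \<open>Negating \<open>a\<close> inverts the matrix, so the determinants in the
    commutator cancel in pairs.\<close>
  have M_inverse: "det (M i j a) * det (M i j (- a)) = 1" if "i \<noteq> j" for i j a
  proof -
    have "matrix_action (M i j a ** M i j (- a)) = matrix_action (mat 1)"
      using that
      by (simp add: matrix_action_mult M matrix_action_one mult_minus_fun elementary_map_add
          elementary_map_zero)
    then have "M i j a ** M i j (- a) = mat 1"
      using inj_matrix_action by (simp add: inj_eq)
    then show ?thesis
      by (metis det_I det_mul)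
  qed
  obtain a i k where h: "i \<noteq> k" "h = elementary_map i k ((*) a)"
    using assms(2) by (auto simp: elementary_left_mults_eq)
  obtain j where j: "i \<noteq> j" "j \<noteq> k"
    using ex_distinct_index[OF card, of i k] by blast
  \<comment> \<open>The second map is left multiplication by 1, so the composite is again left
    multiplication by \<open>a\<close>.\<close>
  have "matrix_action (M i k a) = matrix_action (M i j a ** M j k 1 ** M i j (- a) ** M j k (- 1))"
    using elementary_map_commutator[OF additive_left_mult_algebra[OF left_mult_algebra.left] j h(1), of a "(*) 1"]
    by (simp add: matrix_action_mult M mult_minus_fun nonassoc_mult_1_left)
  then have "M i k a = M i j a ** M j k 1 ** M i j (- a) ** M j k (- 1)"
    using inj_matrix_action by (simp add: inj_eq)
  then have "det (M i k a) = (det (M i j a) * det (M i j (- a))) * (det (M j k 1) * det (M j k (- 1)))"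
    by (simp add: det_mul)
  then have "det (M i k a) = 1"
    using M_inverse j by simp
  then show ?thesis
    using h M by metis
qed

lemma SL_matrix_action:
  assumes card: "CARD('m) \<ge> 3" and "h \<in> carrier SL"
  shows "\<exists>A. det A = 1 \<and> h = matrix_action A"
  using assms(2) unfolding carrier_SL
proof induction
  case one
  then show ?case
    by (intro exI[of _ "mat 1"]) (simp add: BijGroup_UNIV_simps matrix_action_one)
next
  case (incl h)
  then show ?case using elementary_left_mults_matrix_action[OF card] by blast
next
  case (inv h)
  then obtain A where A: "det A = 1" "h = matrix_action A"
    using elementary_left_mults_matrix_action[OF card] by blast
  \<comment> \<open>The inverse matrix acts as a two-sided inverse, which uniqueness identifies with
    the inverse in \<open>BijGroup UNIV\<close>.\<close>
  then obtain B where inverse: "A ** B = mat 1" "B ** A = mat 1" and "det B = 1"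
    using det_1_inverse by blast
  moreover have "matrix_action B \<in> carrier (BijGroup UNIV)"
    using inverse by (auto simp: BijGroup_UNIV_simps matrix_action_one
        simp flip: matrix_action_mult intro!: o_bij[of "matrix_action A"])
  moreover have "h \<in> carrier (BijGroup UNIV)"
    using elementary_left_mults_subset inv by blast
  ultimately have "inv\<^bsub>BijGroup UNIV\<^esub> h = matrix_action B"
    by (intro group.inv_equality group_BijGroup)
      (auto simp: A BijGroup_UNIV_simps matrix_action_one simp flip: matrix_action_mult)
  with \<open>det B = 1\<close> show ?case by blast
next
  case (eng f g)
  then obtain A B where "det A = 1" "f = matrix_action A" "det B = 1" "g = matrix_action B"
    by blast
  then show ?case
    using mult_SL[of f g] eng.hyps
    by (intro exI[of _ "A ** B"]) (simp add: det_mul matrix_action_mult carrier_SL SL_def)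
qed

lemma matrix_action_iso:
  assumes "CARD('m) \<ge> 3"
  shows "matrix_action \<in> iso special_linear_group SL"
proof (rule isoI)
  show "matrix_action \<in> hom special_linear_group SL"
    using matrix_action_in_SL[OF assms]
    by (auto intro!: homI simp: special_linear_group_def matrix_action_mult mult_SL)
  show "bij_betw matrix_action (carrier special_linear_group) (carrier SL)"
    using matrix_action_in_SL[OF assms] SL_matrix_action[OF assms]
    by (auto simp: bij_betw_def special_linear_group_def intro: inj_on_subset[OF inj_matrix_action])
qed

end

text \<open>Lets the isomorphism, built from matrices to \<open>SL\<close>, be reversed.\<close>

lemma group_special_linear_group: "group (special_linear_group :: (real^'n^'n) monoid)"
proof (rule groupI)
  fix A :: "real^'n^'n"
  assume "A \<in> carrier special_linear_group"
  then have "det A = 1" by (simp add: special_linear_group_def)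
  then show "\<exists>B\<in>carrier special_linear_group.
      B \<otimes>\<^bsub>special_linear_group\<^esub> A = \<one>\<^bsub>special_linear_group\<^esub>"
    using det_1_inverse[of A] by (auto simp: special_linear_group_def)
qed (simp_all add: special_linear_group_def det_mul matrix_mul_assoc)

theorem corollary4p2:
  assumes "CARD('m::finite) \<ge> 3"
    and "CARD('n::finite) = 8 * CARD('m)"
  shows "(SL :: (octonion^'m \<Rightarrow> octonion^'m) monoid) \<cong>
    (special_linear_group :: (real^'n^'n) monoid)"
proof -
  \<comment> \<open>There are eight boolean triples, so the dimensions agree and a labelling
    \<open>\<beta>\<close> exists.\<close>
  have "CARD('n) = CARD('m \<times> (bool \<times> bool \<times> bool))"
    using assms(2) by simp
  then obtain \<beta> :: "'n \<Rightarrow> 'm \<times> (bool \<times> bool \<times> bool)" where "bij \<beta>"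
    using finite_same_card_bij[of "UNIV :: 'n set" "UNIV :: ('m \<times> bool \<times> bool \<times> bool) set"]
    by auto
  then have "(special_linear_group :: (real^'n^'n) monoid) \<cong>
      (SL :: (octonion^'m \<Rightarrow> octonion^'m) monoid)"
    using matrix_action_iso[OF _ assms(1)] by (auto simp: is_iso_def)
  then show ?thesis
    by (rule group.iso_sym[OF group_special_linear_group])
qed

end
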